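(* Let $n\ge 1$ be an integer, let $B^n=\{x\in\mathbb{R}^n : \|x\|\le 1\}$, and let $R_n=\sqrt{2(n+1)/n}$. If $f\colon B^n\to B^n$ is $\varepsilon$-continuous, then for any $\varepsilon'>\frac{\varepsilon}{R_n}$ the function $f$ has an $\varepsilon'$-fixed point.
   Context: $\|\cdot\|$ denotes the Euclidean norm on $\mathbb{R}^n$, and $B^n$ carries the Euclidean metric. Functions are not assumed to be continuous. For a metric space $X$, a function $f\colon X\to X$ is called $\varepsilon$-continuous if each point $x\in X$ admits a neighborhood $U_x$ (in $X$) such that the image $f(U_x)$ has diameter at most $\varepsilon$. A point $x\in B^n$ is an $\varepsilon'$-fixed point for $f\colon B^n\to B^n$ if $\|x-f(x)\|\le\varepsilon'$. The number $R_n$ is the diameter (Euclidean edge length) of the regular $n$-simplex inscribed in $B^n$. *)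

theory Defs
  imports "HOL-Analysis.Analysis"
begin

(* Neighborhoods are taken in the subspace X and need not be open.  The library's real-valued
   diameter is unspecified on unbounded sets, hence the boundedness condition. *)
definition eps_continuous_on ::
  "'a::metric_space set \<Rightarrow> real \<Rightarrow> ('a \<Rightarrow> 'b::metric_space) \<Rightarrow> bool"
  where "eps_continuous_on X \<epsilon> f \<longleftrightarrow>
    (\<forall>x\<in>X. \<exists>U\<subseteq>X. (\<exists>W. openin (top_of_set X) W \<and> x \<in> W \<and> W \<subseteq> U) \<and>
                   bounded (f ` U) \<and> diameter (f ` U) \<le> \<epsilon>)"

definition eps_fixed_point :: "real \<Rightarrow> ('a::real_normed_vector \<Rightarrow> 'a) \<Rightarrow> 'a \<Rightarrow> bool"
  where "eps_fixed_point \<epsilon>' f x \<longleftrightarrow> norm (x - f x) \<le> \<epsilon>'"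

(* The edge length of the regular n-simplex inscribed in the unit ball of R^n. *)
definition simplex_edge :: "nat \<Rightarrow> real"
  where "simplex_edge n = sqrt (2 * (real n + 1) / real n)"

end

(* An eps-continuous f on the compact ball satisfies dist (f y) (f z) \<le> eps whenever y and z are
   close, by a Lebesgue number argument. Replacing f by a partition-of-unity average of its values
   and applying Brouwer yields a point x in the convex hull of { f y | y near x }, a set of diameter
   at most eps. As in Jung's theorem, such an x is within eps / R_n of one of these values f y, so
   that y is almost eps / R_n-fixed. *)
theory Submission
  imports Defs
begin

text \<open>Double counting of squared distances. By Caratheodory, \<open>x\<close> is a convex
  combination of at most n + 1 points of \<open>P\<close>. Comparing the weighted mean of the
  squared distances from these points to a heaviest enough one, \<open>w\<close>, with the distances
  to \<open>x\<close> gives a contradiction if all points are farther than \<open>r\<close> from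
  \<open>x\<close>.\<close>

lemma convex_hull_dist_le_simplex_edge:
  fixes x :: "'a::euclidean_space"
  assumes x: "x \<in> convex hull P"
    and diam: "\<And>p q. p \<in> P \<Longrightarrow> q \<in> P \<Longrightarrow> dist p q \<le> e"
  shows "\<exists>p\<in>P. dist x p \<le> e / simplex_edge DIM('a)"
proof (rule ccontr)
  define n where "n = real DIM('a)"
  define r where "r = e / simplex_edge DIM('a)"
  assume "\<not> (\<exists>p\<in>P. dist x p \<le> e / simplex_edge DIM('a))"
  then have far: "r < dist x p" if "p \<in> P" for p
    using that by (auto simp: r_def not_le)
  have n: "n > 0"
    by (simp add: n_def)
  obtain S u where S: "finite S" "S \<subseteq> P" "card S \<le> DIM('a) + 1"
    and u: "\<And>v. v \<in> S \<Longrightarrow> 0 \<le> u v" "sum u S = 1" "(\<Sum>v\<in>S. u v *\<^sub>R v) = x"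
    using x unfolding convex_hull_caratheodory by blast
  have "S \<noteq> {}"
    using u(2) by auto
  then have e: "0 \<le> e"
    using S(2) diam by (metis all_not_in_conv subsetD zero_le_dist order_trans)
  have r: "0 \<le> r"
    using e by (simp add: r_def simplex_edge_def)
  \<comment> \<open>The edge length squared is 2 (n + 1) / n, so this is exactly the value that the
    upper bound at the end reaches.\<close>
  have r2: "2 * r\<^sup>2 = e\<^sup>2 * (1 - 1 / (n + 1))"
    using n by (simp add: r_def simplex_edge_def power_divide n_def[symmetric] field_simps)
  \<comment> \<open>Pigeonhole: at most n + 1 weights sum to 1.\<close>
  obtain w where w: "w \<in> S" "1 / (n + 1) \<le> u w"
  proof (rule ccontr)
    assume "\<not> thesis"
    then have "u v < 1 / (n + 1)" if "v \<in> S" for v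
      using that \<open>\<And>w. w \<in> S \<Longrightarrow> 1 / (n + 1) \<le> u w \<Longrightarrow> thesis\<close> by force
    then have "sum u S < (\<Sum>v\<in>S. 1 / (n + 1))"
      using S(1) \<open>S \<noteq> {}\<close> by (intro sum_strict_mono) auto
    also have "\<dots> \<le> 1"
      using S(3) n by (simp add: field_simps n_def)
    finally show False
      using u(2) by simp
  qed
  \<comment> \<open>\<open>x\<close> is the barycentre of the weighted points, so the cross terms of
    \<open>expand\<close> cancel.\<close>
  have centred: "(\<Sum>v\<in>S. u v * ((v - x) \<bullet> (w - x))) = 0"
  proof -
    have "(\<Sum>v\<in>S. u v * ((v - x) \<bullet> (w - x))) = (\<Sum>v\<in>S. u v *\<^sub>R (v - x)) \<bullet> (w - x)"
      by (simp add: inner_sum_left)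
    also have "(\<Sum>v\<in>S. u v *\<^sub>R (v - x)) = 0"
      using u(2,3) by (simp add: scaleR_diff_right sum_subtractf flip: scaleR_left.sum)
    finally show ?thesis
      by simp
  qed
  have expand: "u v * (dist v w)\<^sup>2 =
      u v * (dist x v)\<^sup>2 + u v * (dist x w)\<^sup>2 - 2 * (u v * ((v - x) \<bullet> (w - x)))" for v
    by (simp add: dist_norm power2_norm_eq_inner algebra_simps inner_commute)
  have "r\<^sup>2 = (\<Sum>v\<in>S. u v * r\<^sup>2)"
    using u(2) by (simp flip: sum_distrib_right)
  also have "\<dots> \<le> (\<Sum>v\<in>S. u v * (dist x v)\<^sup>2)"
    using far S(2) r u(1) by (intro sum_mono mult_left_mono power_mono) (auto intro: less_imp_le)
  \<comment> \<open>The strict inequality comes from the single term for \<open>w\<close>.\<close>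
  finally have "2 * r\<^sup>2 < (\<Sum>v\<in>S. u v * (dist x v)\<^sup>2) + (dist x w)\<^sup>2"
    using power_strict_mono[OF far[of w] r, of 2] w(1) S(2) by auto
  also have "(\<Sum>v\<in>S. u v * (dist x v)\<^sup>2) + (dist x w)\<^sup>2 = (\<Sum>v\<in>S. u v * (dist v w)\<^sup>2)"
  proof -
    have "(\<Sum>v\<in>S. u v * (dist v w)\<^sup>2) = (\<Sum>v\<in>S. u v * (dist x v)\<^sup>2)
        + (\<Sum>v\<in>S. u v) * (dist x w)\<^sup>2 - 2 * (\<Sum>v\<in>S. u v * ((v - x) \<bullet> (w - x)))"
      unfolding expand by (simp add: sum.distrib sum_subtractf sum_distrib_left sum_distrib_right)
    then show ?thesis
      using u(2) centred by simp
  qed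
  \<comment> \<open>\<open>w\<close> is at distance 0 from itself, so its weight drops out; this
    produces the factor \<open>1 - u w\<close>.\<close>
  also have "\<dots> = (\<Sum>v\<in>S - {w}. u v * (dist v w)\<^sup>2)"
    using w(1) S(1) by (simp add: sum.remove)
  also have "\<dots> \<le> (\<Sum>v\<in>S - {w}. u v * e\<^sup>2)"
    using w(1) u(1) diam[OF subsetD[OF S(2)] subsetD[OF S(2)]]
    by (intro sum_mono mult_left_mono power_mono) auto
  also have "\<dots> = (1 - u w) * e\<^sup>2"
    using w(1) S(1) u(2) by (simp add: sum_diff1 flip: sum_distrib_right)
  also have "\<dots> \<le> (1 - 1 / (n + 1)) * e\<^sup>2"
    using w(2) by (intro mult_right_mono) auto
  finally show False
    using r2 by (simp add: mult.commute)
qed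

lemma eps_continuous_on_compact_uniform:
  assumes "compact X" "eps_continuous_on X e f"
  obtains d where "d > 0" "\<And>x y. x \<in> X \<Longrightarrow> y \<in> X \<Longrightarrow> dist x y < d \<Longrightarrow> dist (f x) (f y) \<le> e"
proof -
  \<comment> \<open>The sets are open in the whole space, as the Lebesgue number lemma requires;
    only their traces on \<open>X\<close> matter for \<open>f\<close>.\<close>
  define \<G> where "\<G> = {G. open G \<and> (\<forall>x\<in>X \<inter> G. \<forall>y\<in>X \<inter> G. dist (f x) (f y) \<le> e)}"
  have "X \<subseteq> \<Union>\<G>"
  proof
    fix x
    assume "x \<in> X"
    then obtain U W where U: "openin (top_of_set X) W" "x \<in> W" "W \<subseteq> U"
      "bounded (f ` U)" "diameter (f ` U) \<le> e"
      using assms(2) unfolding eps_continuous_on_def by metis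
    obtain G where G: "open G" "W = X \<inter> G"
      using U(1) by (auto simp: openin_open)
    have "dist (f y) (f z) \<le> e" if "y \<in> X \<inter> G" "z \<in> X \<inter> G" for y z
      using that U G diameter_bounded_bound[OF U(4), of "f y" "f z"] by fastforce
    then have "G \<in> \<G>"
      using G(1) by (auto simp: \<G>_def)
    then show "x \<in> \<Union>\<G>"
      using U(2) G(2) by blast
  qed
  moreover have "open G" if "G \<in> \<G>" for G
    using that by (simp add: \<G>_def)
  ultimately obtain d where d: "0 < d" "\<And>x. x \<in> X \<Longrightarrow> \<exists>G\<in>\<G>. ball x d \<subseteq> G"
    using Heine_Borel_lemma[OF assms(1), of \<G>] by metis
  show thesis
  proof
    show "d > 0"
      by (fact d(1))
    fix x y
    assume xy: "x \<in> X" "y \<in> X" "dist x y < d"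
    then obtain G where "G \<in> \<G>" "ball x d \<subseteq> G"
      using d(2) by blast
    moreover have "x \<in> ball x d" "y \<in> ball x d"
      using xy d(1) by auto
    ultimately show "dist (f x) (f y) \<le> e"
      using xy(1,2) unfolding \<G>_def by blast
  qed
qed

text \<open>\<open>f\<close> may be discontinuous, so Brouwer is applied to a continuous
  \<open>g\<close> that averages the values of \<open>f\<close> on a finite \<open>d\<close>-net. At
  a fixed point of \<open>g\<close>, only net points closer than \<open>d\<close> carry
  weight.\<close>

lemma brouwer_convex_hull_of_nearby_values:
  fixes f :: "'a::euclidean_space \<Rightarrow> 'a"
  assumes K: "compact K" "convex K" "K \<noteq> {}" and f: "f \<in> K \<rightarrow> K" and d: "d > 0"
  shows "\<exists>x\<in>K. x \<in> convex hull (f ` {y\<in>K. dist x y < d})"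
proof -
  have "K \<subseteq> (\<Union>t\<in>K. ball t d)"
    using d by force
  then obtain T where T: "finite T" "T \<subseteq> K" "K \<subseteq> (\<Union>t\<in>T. ball t d)"
    using compactE_image[OF K(1), of K "\<lambda>t. ball t d"] open_ball by metis
  \<comment> \<open>Tent functions, positive exactly on \<open>ball t d\<close>; dividing by their
    sum \<open>L\<close> gives a partition of unity on \<open>K\<close>.\<close>
  define l :: "'a \<Rightarrow> 'a \<Rightarrow> real" where "l = (\<lambda>t x. max 0 (d - dist x t))"
  define L where "L = (\<lambda>x. \<Sum>t\<in>T. l t x)"
  define g where "g = (\<lambda>x. \<Sum>t\<in>T. (l t x / L x) *\<^sub>R f t)"
  have l_nonneg: "0 \<le> l t x" for t x
    by (simp add: l_def)
  have L_pos: "0 < L x" if x: "x \<in> K" for x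
  proof -
    obtain t where "t \<in> T" "dist t x < d"
      using T(3) x by auto
    then show ?thesis
      unfolding L_def using T(1) l_nonneg
      by (intro sum_pos2[of T t]) (auto simp: l_def dist_commute)
  qed
  have sum1: "(\<Sum>t\<in>T. l t x / L x) = 1" if "x \<in> K" for x
    using L_pos[OF that] by (simp add: L_def flip: sum_divide_distrib)
  have l_cont: "continuous_on K (l t)" for t
    unfolding l_def by (intro continuous_intros)
  have "continuous_on K L"
    unfolding L_def by (intro continuous_intros l_cont)
  then have "continuous_on K g"
    unfolding g_def by (intro continuous_intros l_cont) (auto dest: L_pos)
  moreover have "g \<in> K \<rightarrow> K"
  proof
    fix x
    assume x: "x \<in> K"
    show "g x \<in> K"
      unfolding g_def using x T f L_pos[OF x] l_nonneg
      by (intro convex_sum[OF T(1) K(2) sum1[OF x]]) auto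
  qed
  ultimately obtain x where x: "x \<in> K" "g x = x"
    using brouwer[OF K] by metis
  define A where "A = {t\<in>T. dist x t < d}"
  have off: "l t x = 0" if "t \<in> T - A" for t
    using that by (auto simp: A_def l_def)
  have A: "finite A" "A \<subseteq> T"
    using T(1) by (auto simp: A_def)
  have "(\<Sum>t\<in>A. l t x / L x) = 1"
    using sum1[OF x(1)] sum.mono_neutral_left[OF T(1) A(2), of "\<lambda>t. l t x / L x"] off by simp
  then have "(\<Sum>t\<in>A. (l t x / L x) *\<^sub>R f t) \<in> convex hull (f ` {y\<in>K. dist x y < d})"
    using A T(2) L_pos[OF x(1)] l_nonneg
    by (intro convex_sum[OF A(1)] hull_inc) (auto simp: A_def)
  moreover have "(\<Sum>t\<in>A. (l t x / L x) *\<^sub>R f t) = x"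
    using x(2) sum.mono_neutral_left[OF T(1) A(2), of "\<lambda>t. (l t x / L x) *\<^sub>R f t"] off
    by (simp add: g_def)
  ultimately show ?thesis
    using x(1) by metis
qed

theorem mainTheorem1:
  fixes f :: "real ^ 'n \<Rightarrow> real ^ 'n" and \<epsilon> \<epsilon>' :: real
  assumes "f \<in> cball 0 1 \<rightarrow> cball 0 1"
    and "eps_continuous_on (cball 0 1) \<epsilon> f"
    and "\<epsilon>' > \<epsilon> / simplex_edge CARD('n)"
  shows "\<exists>x\<in>cball 0 1. eps_fixed_point \<epsilon>' f x"
proof -
  let ?B = "cball 0 1 :: (real ^ 'n) set"
  obtain d where d: "d > 0" "\<And>x y. x \<in> ?B \<Longrightarrow> y \<in> ?B \<Longrightarrow> dist x y < d \<Longrightarrow> dist (f x) (f y) \<le> \<epsilon>"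
    using eps_continuous_on_compact_uniform[OF compact_cball assms(2)] by metis
  \<comment> \<open>The first bound puts any two points that are \<open>h\<close>-close to
    \<open>x\<close> within \<open>d\<close> of each other; the second is the slack left for moving
    from \<open>x\<close> to the nearby point \<open>y\<close>.\<close>
  define h where "h = min (d / 2) (\<epsilon>' - \<epsilon> / simplex_edge CARD('n))"
  have h: "h > 0"
    using d(1) assms(3) by (simp add: h_def)
  obtain x where x: "x \<in> convex hull (f ` {y\<in>?B. dist x y < h})"
    using brouwer_convex_hull_of_nearby_values[OF compact_cball convex_cball _ assms(1) h] by auto
  have "dist (f y) (f z) \<le> \<epsilon>"
    if "y \<in> {y\<in>?B. dist x y < h}" "z \<in> {y\<in>?B. dist x y < h}" for y z
    using that dist_triangle3[of y z x] by (intro d(2)) (auto simp: h_def)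
  then obtain y where y: "y \<in> ?B" "dist x y < h" "dist x (f y) \<le> \<epsilon> / simplex_edge CARD('n)"
    using convex_hull_dist_le_simplex_edge[OF x, of \<epsilon>] by auto
  have "dist y (f y) \<le> \<epsilon>'"
    using y(2,3) dist_triangle3[of y "f y" x] by (simp add: h_def)
  then show ?thesis
    using y(1) by (auto simp: eps_fixed_point_def dist_norm)
qed

end
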